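(* Let $G=(V,E)$ be a finite graph with orientation $\varepsilon$, $A,B$ abelian groups, $\Omega=T(G,\varepsilon;A)\times F(G,\varepsilon;B)$, $R$ a commutative ring, $u,v\in R$, and $\nu$ an $R$-valued valuation on the Boolean algebra $\mathscr B$ of subsets of $\Omega$ generated by the products of a coset of a subgroup of $T(G,\varepsilon;A)$ with a coset of a subgroup of $F(G,\varepsilon;B)$. Then \[ \iint\limits_{\operatorname{supp}f\subseteq\ker g}u^{|\ker f|}v^{|\operatorname{supp}g|}\,d\nu(f,g)=\sum_{Y\subseteq X\subseteq E}(uv)^{|Y|}(u-uv-1)^{|X-Y|}\,\nu(\Omega_{X,E-Y}). \]
   Context: $T(G,\varepsilon;A)$, $F(G,\varepsilon;B)$ are the groups of $A$-valued tensions (signed sum over each circuit with traversal direction is $0$) and $B$-valued flows (net flow $0$ at every vertex). $\operatorname{supp}f=\{e:f(e)\ne0\}$, $\ker f=E-\operatorname{supp}f$. For $X,Y\subseteq E$: $\Omega_{X,Y}=\{(f,g)\in\Omega:f|_X=0,\ g|_Y=0\}$ and $\Omega^0_{X,Y}=\{(f,g)\in\Omega:\ker f=X,\ \ker g=Y\}$; both lie in $\mathscr B$. A valuation satisfies $\nu(\emptyset)=0$ and $\nu(S\cup S')+\nu(S\cap S')=\nu(S)+\nu(S')$. For a condition $P$ on $(\ker f,\ker g)$ and a weight $w(f,g)=w_{X,Y}$ depending only on $(X,Y)=(\ker f,\ker g)$, the integral is $\iint_P w\,d\nu:=\sum_{(X,Y)\text{ satisfying }P}w_{X,Y}\,\nu(\Omega^0_{X,Y})$.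 Convention $0^0=1$. *)

theory Defs
  imports
    "Graph_Theory.Arc_Walk"
    "HOL-Algebra.Coset"
    "HOL-Analysis.Sigma_Algebra"
begin

text \<open>
  A finite graph (loops and parallel edges allowed) together with an orientation is a
  \<^locale>\<open>fin_digraph\<close>: \<^const>\<open>tail\<close> and \<^const>\<open>head\<close> give the
  direction that the orientation assigns to each edge. Circuits live in the underlying undirected
  graph, so they may traverse an edge against its orientation: in the digraph below the arc
  \<open>(e, True)\<close> is \<open>e\<close> traversed from tail to head and \<open>(e, False)\<close> is \<open>e\<close>
  traversed from head to tail.
\<close>

definition traversals :: "('v, 'e) pre_digraph \<Rightarrow> ('v, 'e \<times> bool) pre_digraph" where
  "traversals G =
     \<lparr>verts = verts G,
      arcs = arcs G \<times> UNIV,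
      tail = (\<lambda>(e, b). if b then tail G e else head G e),
      head = (\<lambda>(e, b). if b then head G e else tail G e)\<rparr>"

text \<open>
  Without the distinctness condition on edges, going back and forth along a single
  non-loop edge would count as a circuit.
\<close>

definition directed_circuit :: "('v, 'e) pre_digraph \<Rightarrow> ('e \<times> bool) list \<Rightarrow> bool" where
  "directed_circuit G p \<longleftrightarrow> pre_digraph.cycle (traversals G) p \<and> distinct (map fst p)"

text \<open>
  Functions on the edge set are represented by total functions that vanish outside it.
\<close>

definition tensions :: "('v, 'e) pre_digraph \<Rightarrow> ('e \<Rightarrow> 'a::ab_group_add) set" where
  "tensions G =
     {f. (\<forall>e. e \<notin> arcs G \<longrightarrow> f e = 0) \<and>
         (\<forall>p. directed_circuit G p \<longrightarrow> (\<Sum>(e, b)\<leftarrow>p. if b then f e else - f e) = 0)}"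

definition flows :: "('v, 'e) pre_digraph \<Rightarrow> ('e \<Rightarrow> 'b::ab_group_add) set" where
  "flows G =
     {g. (\<forall>e. e \<notin> arcs G \<longrightarrow> g e = 0) \<and>
         (\<forall>v\<in>verts G. (\<Sum>e\<in>out_arcs G v. g e) - (\<Sum>e\<in>in_arcs G v. g e) = 0)}"

definition tension_group :: "('v, 'e) pre_digraph \<Rightarrow> ('e \<Rightarrow> 'a::ab_group_add) monoid" where
  "tension_group G = \<lparr>carrier = tensions G, mult = (\<lambda>f f' e. f e + f' e), one = (\<lambda>e. 0)\<rparr>"

definition flow_group :: "('v, 'e) pre_digraph \<Rightarrow> ('e \<Rightarrow> 'b::ab_group_add) monoid" where
  "flow_group G = \<lparr>carrier = flows G, mult = (\<lambda>g g' e. g e + g' e), one = (\<lambda>e. 0)\<rparr>"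

lemma comm_group_tension_group:
  fixes G :: "('v, 'e) pre_digraph"
  shows "comm_group (tension_group G :: ('e \<Rightarrow> 'a::ab_group_add) monoid)"
proof -
  have add: "(\<Sum>(e, b)\<leftarrow>p. if b then f e + f' e else - (f e + f' e)) =
      (\<Sum>(e, b)\<leftarrow>p. if b then f e else - f e) + (\<Sum>(e, b)\<leftarrow>p. if b then f' e else - f' e)"
    for p :: "('e \<times> bool) list" and f f' :: "'e \<Rightarrow> 'a"
    by (induction p) (auto simp: algebra_simps)
  have neg: "(\<Sum>(e, b)\<leftarrow>p. if b then - f e else - (- f e)) =
      - (\<Sum>(e, b)\<leftarrow>p. if b then f e else - f e)"
    for p :: "('e \<times> bool) list" and f :: "'e \<Rightarrow> 'a"
    by (induction p) (auto simp: algebra_simps)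
  have zero: "(\<Sum>(e, b)\<leftarrow>p. if b then 0 else - 0) = (0 :: 'a)"
    for p :: "('e \<times> bool) list"
    by (induction p) auto
  have closed: "(\<lambda>e. f e + f' e) \<in> tensions G" if "f \<in> tensions G" "f' \<in> tensions G"
    for f f' :: "'e \<Rightarrow> 'a"
    using that unfolding tensions_def mem_Collect_eq add by simp
  have inv: "(\<lambda>e. - f e) \<in> tensions G" if "f \<in> tensions G" for f :: "'e \<Rightarrow> 'a"
    using that unfolding tensions_def mem_Collect_eq neg by simp
  have one: "(\<lambda>e. 0 :: 'a) \<in> tensions G"
    unfolding tensions_def mem_Collect_eq zero by simp
  show ?thesis
  proof (rule comm_groupI)
    fix f :: "'e \<Rightarrow> 'a" assume "f \<in> carrier (tension_group G)"
    with inv show "\<exists>f'\<in>carrier (tension_group G). f' \<otimes>\<^bsub>tension_group G\<^esub> f = \<one>\<^bsub>tension_group G\<^esub>"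
      by (intro bexI[of _ "\<lambda>e. - f e"]) (auto simp: tension_group_def)
  qed (auto simp: tension_group_def closed one add_ac)
qed

lemma comm_group_flow_group: "comm_group (flow_group G)"
proof (rule comm_groupI)
  fix g assume "g \<in> carrier (flow_group G)"
  then show "\<exists>g'\<in>carrier (flow_group G). g' \<otimes>\<^bsub>flow_group G\<^esub> g = \<one>\<^bsub>flow_group G\<^esub>"
    by (intro bexI[of _ "\<lambda>e. - g e"]) (auto simp: flow_group_def flows_def sum_negf)
qed (auto simp: flow_group_def flows_def sum.distrib add_ac)

definition Omega ::
  "('v, 'e) pre_digraph \<Rightarrow> (('e \<Rightarrow> 'a::ab_group_add) \<times> ('e \<Rightarrow> 'b::ab_group_add)) set" where
  "Omega G = carrier (tension_group G) \<times> carrier (flow_group G)"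

definition coset_products ::
  "('v, 'e) pre_digraph \<Rightarrow> (('e \<Rightarrow> 'a::ab_group_add) \<times> ('e \<Rightarrow> 'b::ab_group_add)) set set" where
  "coset_products G =
     {C \<times> D | C D H K.
        subgroup H (tension_group G) \<and> C \<in> rcosets\<^bsub>tension_group G\<^esub> H \<and>
        subgroup K (flow_group G) \<and> D \<in> rcosets\<^bsub>flow_group G\<^esub> K}"

definition coset_algebra ::
  "('v, 'e) pre_digraph \<Rightarrow> (('e \<Rightarrow> 'a::ab_group_add) \<times> ('e \<Rightarrow> 'b::ab_group_add)) set set" where
  "coset_algebra G = algebra (Omega G) hull coset_products G"

definition valuation_on :: "'x set set \<Rightarrow> ('x set \<Rightarrow> 'r::comm_ring) \<Rightarrow> bool" where
  "valuation_on \<B> \<nu> \<longleftrightarrow>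
     \<nu> {} = 0 \<and> (\<forall>S\<in>\<B>. \<forall>S'\<in>\<B>. \<nu> (S \<union> S') + \<nu> (S \<inter> S') = \<nu> S + \<nu> S')"

definition supp :: "('v, 'e) pre_digraph \<Rightarrow> ('e \<Rightarrow> 'a::zero) \<Rightarrow> 'e set" where
  "supp G f = {e \<in> arcs G. f e \<noteq> 0}"

definition ker :: "('v, 'e) pre_digraph \<Rightarrow> ('e \<Rightarrow> 'a::zero) \<Rightarrow> 'e set" where
  "ker G f = arcs G - supp G f"

definition Omega_sub ::
  "('v, 'e) pre_digraph \<Rightarrow> 'e set \<Rightarrow> 'e set \<Rightarrow>
     (('e \<Rightarrow> 'a::ab_group_add) \<times> ('e \<Rightarrow> 'b::ab_group_add)) set" where
  "Omega_sub G X Y = {(f, g) \<in> Omega G. (\<forall>e\<in>X. f e = 0) \<and> (\<forall>e\<in>Y. g e = 0)}"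

definition Omega_ker ::
  "('v, 'e) pre_digraph \<Rightarrow> 'e set \<Rightarrow> 'e set \<Rightarrow>
     (('e \<Rightarrow> 'a::ab_group_add) \<times> ('e \<Rightarrow> 'b::ab_group_add)) set" where
  "Omega_ker G X Y = {(f, g) \<in> Omega G. ker G f = X \<and> ker G g = Y}"

text \<open>
  The condition \<open>P\<close> and the weight \<open>w\<close> are given as functions of the pair
  \<open>(X, Y)\<close> of kernels of \<open>f\<close> and \<open>g\<close>; the supports are then
  \<open>arcs G - X\<close> and \<open>arcs G - Y\<close>.
\<close>

definition kernel_integral ::
  "('v, 'e) pre_digraph \<Rightarrow>
   ((('e \<Rightarrow> 'a::ab_group_add) \<times> ('e \<Rightarrow> 'b::ab_group_add)) set \<Rightarrow> 'r::comm_ring) \<Rightarrow>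
   ('e set \<Rightarrow> 'e set \<Rightarrow> bool) \<Rightarrow> ('e set \<Rightarrow> 'e set \<Rightarrow> 'r) \<Rightarrow> 'r" where
  "kernel_integral G \<nu> P w =
     (\<Sum>(X, Y) \<in> {(X, Y). X \<subseteq> arcs G \<and> Y \<subseteq> arcs G \<and> P X Y}. w X Y * \<nu> (Omega_ker G X Y))"

end

theory Submission
  imports Defs
begin

text \<open>
  Both sides expand over the atoms \<open>\<Omega>\<^sup>0\<^bsub>X,Y\<^esub>\<close>, because \<open>\<Omega>\<^bsub>X,Y\<^esub>\<close> is the disjoint union of the atoms with
  larger indices. With \<open>S = E - Y\<close>, the atom \<open>\<Omega>\<^sup>0\<^bsub>Z,Y\<^esub>\<close> occurs on the right with coefficient
  \<open>\<Sum> (uv)\<^bsup>|Y'|\<^esup> (u - uv - 1)\<^bsup>|X'-Y'|\<^esup>\<close> over all \<open>S \<subseteq> Y' \<subseteq> X' \<subseteq> Z\<close>. Two applications of the binomial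
  theorem collapse this to \<open>(uv)\<^bsup>|S|\<^esup> u\<^bsup>|Z-S|\<^esup> = u\<^bsup>|Z|\<^esup> v\<^bsup>|S|\<^esup>\<close>, the coefficient on the left.
\<close>

section \<open>Binomial sums over intervals of edge sets\<close>

(* The library's binomial theorems need comm_semiring_1, which excludes the zero ring. *)
lemma sum_between_powers:
  fixes a b :: "'r::{comm_ring, comm_monoid_mult}"
  assumes "finite B" "A \<subseteq> B"
  shows "(\<Sum>Y | A \<subseteq> Y \<and> Y \<subseteq> B. a ^ card (Y - A) * b ^ card (B - Y)) = (a + b) ^ card (B - A)"
proof -
  \<comment> \<open>With \<open>B\<close> written as \<open>A \<union> D\<close>, the induction adds
    points only to the free part \<open>D\<close> while the lower end \<open>A\<close> stays
    fixed.\<close>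
  have "(\<Sum>Y | A \<subseteq> Y \<and> Y \<subseteq> A \<union> D. a ^ card (Y - A) * b ^ card (A \<union> D - Y)) = (a + b) ^ card D"
    if "finite D" "finite A" "A \<inter> D = {}" for D
    using that
  proof (induction D)
    case empty
    then have "{Y. A \<subseteq> Y \<and> Y \<subseteq> A \<union> {}} = {A}" by auto
    then show ?case by simp
  next
    case (insert x D)
    let ?I = "{Y. A \<subseteq> Y \<and> Y \<subseteq> A \<union> D}"
    let ?t = "\<lambda>Y. a ^ card (Y - A) * b ^ card (A \<union> D - Y)"
    let ?s = "\<lambda>Y. a ^ card (Y - A) * b ^ card (A \<union> insert x D - Y)"
    have x: "x \<notin> A" "x \<notin> D" and D: "finite D" "finite A" "A \<inter> D = {}"
      using insert.hyps insert.prems by auto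
    have fin: "finite ?I"
      by (rule finite_subset[of _ "Pow (A \<union> D)"]) (use D in auto)
    have "x \<notin> Y" if "Y \<in> ?I" for Y using that x by auto
    then have inj: "inj_on (insert x) ?I" by (intro inj_onI) (meson insert_ident)
    \<comment> \<open>Sets of the enlarged interval are sorted by whether they contain
      \<open>x\<close>; \<open>insert x\<close> maps the first half bijectively onto the
      second.\<close>
    have split: "{Y. A \<subseteq> Y \<and> Y \<subseteq> A \<union> insert x D} = ?I \<union> insert x ` ?I" (is "?L = ?R")
    proof
      show "?L \<subseteq> ?R"
      proof
        fix Y assume Y: "Y \<in> ?L"
        show "Y \<in> ?R"
        proof (cases "x \<in> Y")
          case True
          then have "Y = insert x (Y - {x})" "Y - {x} \<in> ?I" using Y x by auto
          then show ?thesis by blast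
        next
          case False
          then show ?thesis using Y by auto
        qed
      qed
    qed (use x in auto)
    \<comment> \<open>The new point \<open>x\<close> falls into the complement here and contributes
      a factor \<open>b\<close>; in the other half it lies in the set and contributes
      \<open>a\<close>.\<close>
    have without: "?s Y = b * ?t Y" if "Y \<in> ?I" for Y
    proof -
      have "A \<union> insert x D - Y = insert x (A \<union> D - Y)" using that x by auto
      then show ?thesis using D x by (simp add: mult_ac)
    qed
    have "with": "?s (insert x Y) = a * ?t Y" if "Y \<in> ?I" for Y
    proof -
      have "insert x Y - A = insert x (Y - A)" "x \<notin> Y - A"
        and "A \<union> insert x D - insert x Y = A \<union> D - Y"
        and "finite (Y - A)"
        using that x D by (auto intro: finite_subset[of _ "A \<union> D"])
      then show ?thesis by (simp add: mult_ac)
    qed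
    have "sum ?s {Y. A \<subseteq> Y \<and> Y \<subseteq> A \<union> insert x D} = sum ?s ?I + sum ?s (insert x ` ?I)"
      unfolding split by (rule sum.union_disjoint) (use fin x in auto)
    also have "\<dots> = b * sum ?t ?I + a * sum ?t ?I"
      unfolding sum.reindex[OF inj] comp_def sum_distrib_left
      by (intro arg_cong2[of _ _ _ _ "(+)"] sum.cong refl without "with")
    also have "\<dots> = (a + b) * sum ?t ?I" by (simp add: algebra_simps)
    also have "\<dots> = (a + b) ^ card (insert x D)" using insert.IH D x by simp
    finally show ?case .
  qed
  from this[of "B - A"] assms show ?thesis
    by (simp add: Un_absorb1 finite_subset)
qed

text \<open>For fixed \<open>X\<close> the sets \<open>Y\<close> range over an interval, and
  \<open>u * v\<close> and \<open>u - u * v - 1\<close> add up to \<open>u - 1\<close>. The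
  remaining sum over \<open>X\<close> is again binomial, now with bases \<open>u - 1\<close> and
  \<open>1\<close>, which add up to \<open>u\<close>.\<close>

lemma sum_chain_powers:
  fixes u v :: "'r::{comm_ring, comm_monoid_mult}"
  assumes "finite Z" "S \<subseteq> Z"
  shows "(\<Sum>(X, Y) | S \<subseteq> Y \<and> Y \<subseteq> X \<and> X \<subseteq> Z. (u * v) ^ card Y * (u - u * v - 1) ^ card (X - Y))
    = u ^ card Z * v ^ card S"
proof -
  let ?c = "u - u * v - 1"
  have finX: "finite X" if "X \<subseteq> Z" for X using assms that finite_subset by blast
  \<comment> \<open>Extracting the constant factor \<open>(u * v) ^ card S\<close> leaves exponents
    counted relative to \<open>S\<close>, as the binomial sum requires.\<close>
  have card_split: "card X = card S + card (X - S)" if "S \<subseteq> X" "X \<subseteq> Z" for X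
    using that finX by (metis card_Diff_subset card_mono le_add_diff_inverse finite_subset)
  have inner: "(\<Sum>Y | S \<subseteq> Y \<and> Y \<subseteq> X. (u * v) ^ card Y * ?c ^ card (X - Y))
      = (u * v) ^ card S * (u - 1) ^ card (X - S)" if "S \<subseteq> X" "X \<subseteq> Z" for X
  proof -
    have "(\<Sum>Y | S \<subseteq> Y \<and> Y \<subseteq> X. (u * v) ^ card Y * ?c ^ card (X - Y))
      = (\<Sum>Y | S \<subseteq> Y \<and> Y \<subseteq> X. (u * v) ^ card S * ((u * v) ^ card (Y - S) * ?c ^ card (X - Y)))"
    proof (rule sum.cong)
      fix Y assume "Y \<in> {Y. S \<subseteq> Y \<and> Y \<subseteq> X}"
      then have "card Y = card S + card (Y - S)" using that by (intro card_split) auto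
      then show "(u * v) ^ card Y * ?c ^ card (X - Y)
          = (u * v) ^ card S * ((u * v) ^ card (Y - S) * ?c ^ card (X - Y))"
        by (simp only: power_add mult.assoc)
    qed simp
    also have "\<dots> = (u * v) ^ card S * (u * v + ?c) ^ card (X - S)"
      by (simp only: sum_distrib_left[symmetric] sum_between_powers[OF finX[OF that(2)] that(1)])
    finally show ?thesis by simp
  qed
  have "(\<Sum>(X, Y) | S \<subseteq> Y \<and> Y \<subseteq> X \<and> X \<subseteq> Z. (u * v) ^ card Y * ?c ^ card (X - Y))
    = (\<Sum>X | S \<subseteq> X \<and> X \<subseteq> Z. \<Sum>Y | S \<subseteq> Y \<and> Y \<subseteq> X. (u * v) ^ card Y * ?c ^ card (X - Y))"
  proof (subst sum.Sigma)
    show "finite {X. S \<subseteq> X \<and> X \<subseteq> Z}"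
      by (rule finite_subset[of _ "Pow Z"]) (use assms in auto)
    show "\<forall>X\<in>{X. S \<subseteq> X \<and> X \<subseteq> Z}. finite {Y. S \<subseteq> Y \<and> Y \<subseteq> X}"
      by (auto intro!: rev_finite_subset[of "Pow Z"] simp: assms)
  qed (rule sum.cong; auto)
  \<comment> \<open>The trivial factor \<open>1 ^ card (Z - X)\<close> supplies the second base of
    the binomial sum.\<close>
  also have "\<dots> = (u * v) ^ card S * (\<Sum>X | S \<subseteq> X \<and> X \<subseteq> Z. (u - 1) ^ card (X - S) * 1 ^ card (Z - X))"
    by (simp add: inner sum_distrib_left)
  also have "\<dots> = (u * v) ^ card S * u ^ card (Z - S)"
    unfolding sum_between_powers[OF assms] by simp
  \<comment> \<open>The \<open>u\<close>-part of \<open>(u * v) ^ card S\<close> joins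
    \<open>u ^ card (Z - S)\<close> to give \<open>u ^ card Z\<close>.\<close>
  also have "\<dots> = u ^ card Z * v ^ card S"
    unfolding card_split[OF assms(2) order_refl] power_mult_distrib power_add by (simp only: mult_ac)
  finally show ?thesis .
qed

section \<open>Valuations and membership in the coset algebra\<close>

text \<open>For disjoint sets the intersection term of the valuation identity is
  \<open>\<nu> {} = 0\<close>; induction extends this to finite families, since the algebra contains
  the partial unions.\<close>

lemma valuation_on_UN_disjoint:
  assumes "algebra U \<B>" "valuation_on \<B> \<nu>"
    and "finite I" "disjoint_family_on A I" "\<And>i. i \<in> I \<Longrightarrow> A i \<in> \<B>"
  shows "\<nu> (\<Union>i\<in>I. A i) = (\<Sum>i\<in>I. \<nu> (A i))"
  using assms(3-5)
proof (induction I)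
  case empty
  then show ?case using assms(2) by (simp add: valuation_on_def)
next
  case (insert i I)
  interpret algebra U \<B> by fact
  have "A i \<inter> (\<Union>j\<in>I. A j) = {}"
    using insert.hyps insert.prems(1) by (auto simp: disjoint_family_on_def)
  moreover have "(\<Union>j\<in>I. A j) \<in> \<B>" using insert by (intro finite_UN) auto
  ultimately have "\<nu> (A i \<union> (\<Union>j\<in>I. A j)) = \<nu> (A i) + \<nu> (\<Union>j\<in>I. A j)"
    using assms(2) insert.prems(2)[of i] unfolding valuation_on_def by (metis add.right_neutral insertI1)
  moreover have "disjoint_family_on A I"
    using insert.prems(1) by (auto simp: disjoint_family_on_def)
  ultimately show ?case using insert by simp
qed

lemma coset_products_subset:
  fixes G :: "('v, 'e) pre_digraph"
  shows "(coset_products G :: (('e \<Rightarrow> 'a::ab_group_add) \<times> ('e \<Rightarrow> 'b::ab_group_add)) set set)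
    \<subseteq> Pow (Omega G)"
proof
  fix P :: "(('e \<Rightarrow> 'a) \<times> ('e \<Rightarrow> 'b)) set" assume "P \<in> coset_products G"
  then obtain C D H K where P: "P = C \<times> D"
    and C: "subgroup H (tension_group G)" "C \<in> rcosets\<^bsub>tension_group G\<^esub> H"
    and D: "subgroup K (flow_group G)" "D \<in> rcosets\<^bsub>flow_group G\<^esub> K"
    unfolding coset_products_def by blast
  have "C \<subseteq> carrier (tension_group G)"
    by (rule subgroup.rcosets_carrier[OF C(1) comm_group.axioms(2)[OF comm_group_tension_group] C(2)])
  moreover have "D \<subseteq> carrier (flow_group G)"
    by (rule subgroup.rcosets_carrier[OF D(1) comm_group.axioms(2)[OF comm_group_flow_group] D(2)])
  ultimately show "P \<in> Pow (Omega G)" by (auto simp: P Omega_def)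
qed

text \<open>The hull is the intersection of all algebras on \<open>Omega G\<close> containing the
  coset products. The full power set is one of them, which bounds the hull, and the closure
  conditions pass to intersections.\<close>

lemma algebra_coset_algebra: "algebra (Omega G) (coset_algebra G)"
proof -
  have "coset_algebra G \<subseteq> Pow (Omega G)"
    unfolding coset_algebra_def
    by (rule hull_minimal[of "coset_products G"]) (use coset_products_subset algebra_Pow in auto)
  then show ?thesis
    unfolding algebra_iff_Un coset_algebra_def hull_def by auto
qed

text \<open>Stated for any group of functions with pointwise addition, so that it serves tensions
  and flows alike.\<close>

lemma subgroup_vanishing:
  fixes H :: "('e \<Rightarrow> 'c::ab_group_add) monoid" (structure)
  assumes "group H" and add: "\<And>f g. f \<otimes> g = (\<lambda>e. f e + g e)" and zero: "\<one> = (\<lambda>e. 0)"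
  shows "subgroup {f \<in> carrier H. \<forall>e\<in>X. f e = 0} H"
proof -
  interpret group H by fact
  show ?thesis
  proof (rule subgroupI)
    fix f assume f: "f \<in> {f \<in> carrier H. \<forall>e\<in>X. f e = 0}"
    \<comment> \<open>The abstract group inverse is identified with pointwise negation by evaluating
      this equation at each \<open>e\<close>; hence it vanishes wherever \<open>f\<close>
      does.\<close>
    then have "inv f \<otimes> f = \<one>" by simp
    then have "(inv f) e + f e = 0" for e unfolding add zero by (rule fun_cong)
    then have "(inv f) e = - f e" for e by (simp add: eq_neg_iff_add_eq_0)
    then show "inv f \<in> {f \<in> carrier H. \<forall>e\<in>X. f e = 0}" using f by simp
  next
    have "\<one> \<in> {f \<in> carrier H. \<forall>e\<in>X. f e = 0}" using one_closed by (simp add: zero)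
    then show "{f \<in> carrier H. \<forall>e\<in>X. f e = 0} \<noteq> {}" by blast
  next
    fix f g assume "f \<in> {f \<in> carrier H. \<forall>e\<in>X. f e = 0}" "g \<in> {f \<in> carrier H. \<forall>e\<in>X. f e = 0}"
    then show "f \<otimes> g \<in> {f \<in> carrier H. \<forall>e\<in>X. f e = 0}"
      using m_closed[of f g] by (simp add: add)
  qed auto
qed

text \<open>The set is a product of two subgroups, each of which is a coset of itself, so it is
  already a generator.\<close>

lemma Omega_sub_in_coset_algebra:
  fixes G :: "('v, 'e) pre_digraph"
  shows "(Omega_sub G X Y :: (('e \<Rightarrow> 'a::ab_group_add) \<times> ('e \<Rightarrow> 'b::ab_group_add)) set)
    \<in> coset_algebra G" (is "?O \<in> _")
proof -
  let ?T = "tension_group G :: ('e \<Rightarrow> 'a) monoid"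
  let ?F = "flow_group G :: ('e \<Rightarrow> 'b) monoid"
  have T: "group ?T" by (rule comm_group.axioms(2)[OF comm_group_tension_group])
  have F: "group ?F" by (rule comm_group.axioms(2)[OF comm_group_flow_group])
  let ?H = "{f \<in> carrier ?T. \<forall>e\<in>X. f e = 0}"
  let ?K = "{g \<in> carrier ?F. \<forall>e\<in>Y. g e = 0}"
  have H: "subgroup ?H ?T"
    by (rule subgroup_vanishing[OF T]) (simp_all add: tension_group_def)
  have K: "subgroup ?K ?F"
    by (rule subgroup_vanishing[OF F]) (simp_all add: flow_group_def)
  have "?O = ?H \<times> ?K" by (auto simp: Omega_sub_def Omega_def)
  then have "?O \<in> coset_products G"
    unfolding coset_products_def
    using H K subgroup.subgroup_in_rcosets[OF H T] subgroup.subgroup_in_rcosets[OF K F] by blast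
  then show ?thesis unfolding coset_algebra_def by (rule subsetD[OF hull_subset])
qed

lemma Omega_ker_in_coset_algebra:
  assumes "finite (arcs G)" "X \<subseteq> arcs G" "Y \<subseteq> arcs G"
  shows "Omega_ker G X Y \<in> coset_algebra G" (is "?O \<in> _")
proof -
  interpret algebra "Omega G" "coset_algebra G" by (rule algebra_coset_algebra)
  \<comment> \<open>The kernels are exactly \<open>X\<close> and \<open>Y\<close> when
    \<open>f\<close> and \<open>g\<close> vanish there and at no further edge. Each further edge
    excludes one set from the algebra, and there are finitely many edges.\<close>
  have "?O = Omega_sub G X Y - (\<Union>e\<in>arcs G - X. Omega_sub G {e} {})
      - (\<Union>e\<in>arcs G - Y. Omega_sub G {} {e})"
    using assms(2,3) by (auto simp: Omega_ker_def Omega_sub_def ker_def supp_def)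
  then show ?thesis
    using assms(1) by (simp only:) (intro Diff finite_UN finite_Diff Omega_sub_in_coset_algebra)
qed

section \<open>Decomposition into atoms with prescribed kernels\<close>

text \<open>Each pair lies in the atom indexed by its own kernels, and vanishing on \<open>X\<close>
  means that the kernel contains \<open>X\<close>.\<close>

lemma Omega_sub_eq_UN_Omega_ker:
  fixes G :: "('v, 'e) pre_digraph"
  assumes "X \<subseteq> arcs G" "Y \<subseteq> arcs G"
  shows "(Omega_sub G X Y :: (('e \<Rightarrow> 'a::ab_group_add) \<times> ('e \<Rightarrow> 'b::ab_group_add)) set)
    = (\<Union>(X', Y') \<in> {(X', Y') \<in> Pow (arcs G) \<times> Pow (arcs G). X \<subseteq> X' \<and> Y \<subseteq> Y'}. Omega_ker G X' Y')"
proof (rule Set.set_eqI)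
  fix p :: "('e \<Rightarrow> 'a) \<times> ('e \<Rightarrow> 'b)"
  obtain f g where p: "p = (f, g)" by (cases p)
  have kers: "ker G f \<subseteq> arcs G" "ker G g \<subseteq> arcs G" by (auto simp: ker_def)
  have "(\<forall>e\<in>X. f e = 0) \<longleftrightarrow> X \<subseteq> ker G f" "(\<forall>e\<in>Y. g e = 0) \<longleftrightarrow> Y \<subseteq> ker G g"
    using assms by (auto simp: ker_def supp_def)
  then show "p \<in> Omega_sub G X Y \<longleftrightarrow>
      p \<in> (\<Union>(X', Y') \<in> {(X', Y') \<in> Pow (arcs G) \<times> Pow (arcs G). X \<subseteq> X' \<and> Y \<subseteq> Y'}. Omega_ker G X' Y')"
    using kers by (simp add: p Omega_ker_def Omega_sub_def) blast
qed

lemma valuation_Omega_sub: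
  assumes "finite (arcs G)" "valuation_on (coset_algebra G) \<nu>" "X \<subseteq> arcs G" "Y \<subseteq> arcs G"
  shows "\<nu> (Omega_sub G X Y) =
    (\<Sum>(X', Y') \<in> {(X', Y') \<in> Pow (arcs G) \<times> Pow (arcs G). X \<subseteq> X' \<and> Y \<subseteq> Y'}. \<nu> (Omega_ker G X' Y'))"
    (is "_ = sum _ ?I")
proof -
  have "finite ?I"
    by (rule finite_subset[of _ "Pow (arcs G) \<times> Pow (arcs G)"]) (use assms in auto)
  \<comment> \<open>A pair determines its kernels, so atoms with different indices are disjoint; an
    index may still give an empty atom.\<close>
  moreover have "disjoint_family_on (\<lambda>(X', Y'). Omega_ker G X' Y') ?I"
    by (auto simp: disjoint_family_on_def Omega_ker_def)
  ultimately have "\<nu> (\<Union>(X', Y') \<in> ?I. Omega_ker G X' Y') = (\<Sum>i \<in> ?I. \<nu> (case i of (X', Y') \<Rightarrow> Omega_ker G X' Y'))"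
    by (rule valuation_on_UN_disjoint[OF algebra_coset_algebra assms(2)])
      (auto intro: Omega_ker_in_coset_algebra assms)
  then show ?thesis
    unfolding Omega_sub_eq_UN_Omega_ker[OF assms(3,4)] by (simp add: case_prod_unfold)
qed

section \<open>Comparing coefficients of the atoms\<close>

theorem theorem6p1:
  fixes G :: "('v, 'e) pre_digraph"
    and \<nu> :: "(('e \<Rightarrow> 'a::ab_group_add) \<times> ('e \<Rightarrow> 'b::ab_group_add)) set
               \<Rightarrow> 'r::{comm_ring, comm_monoid_mult}"
    and u v :: 'r
  assumes "fin_digraph G"
    and "valuation_on (coset_algebra G) \<nu>"
  shows "kernel_integral G \<nu>
           (\<lambda>X Y. arcs G - X \<subseteq> Y)
           (\<lambda>X Y. u ^ card X * v ^ card (arcs G - Y)) =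
         (\<Sum>(X, Y) \<in> {(X, Y). Y \<subseteq> X \<and> X \<subseteq> arcs G}.
            (u * v) ^ card Y * (u - u * v - 1) ^ card (X - Y) * \<nu> (Omega_sub G X (arcs G - Y)))"
proof -
  let ?E = "arcs G"
  let ?P = "Pow ?E \<times> Pow ?E"
  let ?C = "{(X, Y). Y \<subseteq> X \<and> X \<subseteq> ?E}"
  define w where "w = (\<lambda>(X, Y :: 'e set). (u * v) ^ card Y * (u - u * v - 1) ^ card (X - Y) :: 'r)"
  define n where "n = (\<lambda>(X, Y). \<nu> (Omega_ker G X Y))"
  \<comment> \<open>For index pairs inside the edge set, \<open>R (X, Y) (X', Y')\<close> says that
    the atom of \<open>(X', Y')\<close> occurs in the decomposition of
    \<open>Omega_sub G X (?E - Y)\<close>.\<close>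
  define R where "R = (\<lambda>(X :: 'e set, Y) (X', Y'). X \<subseteq> X' \<and> ?E - Y \<subseteq> (Y' :: 'e set))"
  have fin: "finite ?E" using assms(1) by (rule fin_digraph.finite_arcs)
  have finC: "finite ?C" by (rule finite_subset[of _ ?P]) (use fin in auto)
  have coeff: "(\<Sum>c | c \<in> ?C \<and> R c (X', Y'). w c)
      = (if ?E - X' \<subseteq> Y' then u ^ card X' * v ^ card (?E - Y') else 0)"
    if "X' \<subseteq> ?E" "Y' \<subseteq> ?E" for X' Y'
  proof -
    \<comment> \<open>Complementing turns \<open>?E - Y \<subseteq> Y'\<close> into
      \<open>?E - Y' \<subseteq> Y\<close>, so the support of \<open>g\<close> becomes the lower end
      of the chain and the kernel of \<open>f\<close> the upper end.\<close>
    have chains: "{c. c \<in> ?C \<and> R c (X', Y')} = {(X, Y). ?E - Y' \<subseteq> Y \<and> Y \<subseteq> X \<and> X \<subseteq> X'}"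
      using that by (auto simp: R_def)
    show ?thesis
    proof (cases "?E - X' \<subseteq> Y'")
      case True
      then have "?E - Y' \<subseteq> X'" by auto
      with True show ?thesis
        using sum_chain_powers[of X' "?E - Y'" u v] that fin
        unfolding chains w_def by (simp add: finite_subset)
    \<comment> \<open>If the support of \<open>f\<close> is not contained in the kernel of
      \<open>g\<close>, the lower end is not below the upper end and no chain exists. The zero
      coefficient thus produces the integration condition.\<close>
    next
      case False
      then have "{(X, Y). ?E - Y' \<subseteq> Y \<and> Y \<subseteq> X \<and> X \<subseteq> X'} = {}" by auto
      with False show ?thesis by (simp only: chains sum.empty if_False)
    qed
  qed
  have "(\<Sum>(X, Y) \<in> ?C. (u * v) ^ card Y * (u - u * v - 1) ^ card (X - Y) * \<nu> (Omega_sub G X (?E - Y)))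
    = (\<Sum>c \<in> ?C. \<Sum>k | k \<in> ?P \<and> R c k. w c * n k)"
  proof (intro sum.cong refl, clarify)
    fix X Y assume "Y \<subseteq> X" "X \<subseteq> ?E"
    then have "\<nu> (Omega_sub G X (?E - Y)) = (\<Sum>k | k \<in> ?P \<and> R (X, Y) k. n k)"
      by (subst valuation_Omega_sub[OF fin assms(2)]) (auto simp: n_def R_def intro!: sum.cong)
    then show "(u * v) ^ card Y * (u - u * v - 1) ^ card (X - Y) * \<nu> (Omega_sub G X (?E - Y))
      = (\<Sum>k | k \<in> ?P \<and> R (X, Y) k. w (X, Y) * n k)"
      by (simp add: w_def sum_distrib_left)
  qed
  \<comment> \<open>Exchanging the two finite sums collects, for each atom \<open>k\<close>, all the
    terms in which it occurs.\<close>
  also have "\<dots> = (\<Sum>k \<in> ?P. \<Sum>c | c \<in> ?C \<and> R c k. w c * n k)"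
    by (rule sum.swap_restrict) (use fin finC in auto)
  also have "\<dots> = (\<Sum>k \<in> ?P. (\<Sum>c | c \<in> ?C \<and> R c k. w c) * n k)"
    by (simp only: sum_distrib_right)
  also have "\<dots> = (\<Sum>(X, Y) \<in> ?P. if ?E - X \<subseteq> Y then u ^ card X * v ^ card (?E - Y) * n (X, Y) else 0)"
  proof (intro sum.cong refl, clarify)
    fix X Y assume "X \<subseteq> ?E" "Y \<subseteq> ?E"
    then show "(\<Sum>c | c \<in> ?C \<and> R c (X, Y). w c) * n (X, Y)
      = (if ?E - X \<subseteq> Y then u ^ card X * v ^ card (?E - Y) * n (X, Y) else 0)"
      by (subst coeff) auto
  qed
  also have "\<dots> = kernel_integral G \<nu> (\<lambda>X Y. ?E - X \<subseteq> Y) (\<lambda>X Y. u ^ card X * v ^ card (?E - Y))"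
    unfolding kernel_integral_def
    \<comment> \<open>Index pairs violating the condition contribute zero and are dropped from the
      range of summation.\<close>
    by (rule sum.mono_neutral_cong_right) (use fin in \<open>auto simp: n_def split: if_splits\<close>)
  finally show ?thesis by simp
qed

end
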